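(* Let $X$ be a pointed metric space, let $E$ be a Banach space, let $1\leq p\leq\infty$, and let $p'$ be the conjugate index of $p$. Then $\mathrm{Lip}_{d_p}(X,E^* )=\Pi^L_{p'}(X,E^* )$ and $\mathrm{Lip}_{d_p}(f)=\pi_{p'}^L(f)$ for every $f\in\mathrm{Lip}_{d_p}(X,E^* )$.
   Context: $\mathbb{K}$ is the field of real or complex numbers. A pointed metric space $X$ is a metric space with metric $d$ and a designated base point $0$; a normed space is pointed by its zero vector. For pointed metric spaces $X,Y$, $\mathrm{Lip}_0(X,Y)$ is the set of base-point preserving Lipschitz maps, $\mathrm{Lip}(f)$ is the least Lipschitz constant, $X^\#=\mathrm{Lip}_0(X,\mathbb K)$ with norm $\mathrm{Lip}$, and $B_{X^\#}$ is its closed unit ball. $E^*$ is the topological dual of $E$. The Lipschitz tensor product $X\boxtimes E$ is the linear span of all linear functionals $\delta_{(x,y)}\boxtimes e$ on $\mathrm{Lip}_0(X,E^* )$ of the form $(\delta_{(x,y)}\boxtimes e)(f)=\langle f(x)-f(y),e\rangle$, for $x,y\in X$ and $e\in E$. A norm $\alpha$ on $X\boxtimes E$ is a Lipschitz cross-norm if $\alpha(\delta_{(x,y)}\boxtimes e)=d(x,y)\|e\|$ always. The Lipschitz $p$-nuclear norm (a Lipschitz cross-norm) is $$d_p(u)=\inf\Big\{\Big(\sup_{g\in B_{X^\#}}\Big(\sum_{i=1}^n|g(x_i)-g(y_i)|^{p'}\Big)^{1/p'}\Big)\Big(\sum_{i=1}^n\|e_i\|^p\Big)^{1/p}\colon u=\sum_{i=1}^n\delta_{(x_i,y_i)}\boxtimes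 e_i\Big\},$$ with sums to the power $1/\infty$ replaced by maxima as usual. For a Lipschitz cross-norm $\alpha$ on $X\boxtimes E$, a base-point preserving map $f\colon X\to E^*$ is an $\alpha$-Lipschitz operator if there is $C\ge 0$ with $\left|\sum_{i=1}^n\langle f(x_i)-f(y_i),e_i\rangle\right|\le C\,\alpha\left(\sum_{i=1}^n\delta_{(x_i,y_i)}\boxtimes e_i\right)$ for all $\sum_{i=1}^n\delta_{(x_i,y_i)}\boxtimes e_i\in X\boxtimes E$; the infimum of such $C$ is $\mathrm{Lip}_\alpha(f)$, and $\mathrm{Lip}_\alpha(X,E^* )$ is the set of all such maps. For $1\le q\le\infty$, a map $f\in\mathrm{Lip}_0(X,Y)$ is Lipschitz $q$-summing if there is $C\ge0$ such that for all $n$ and all $x_1,\dots,x_n,y_1,\dots,y_n\in X$, $$\Big(\sum_{i=1}^n d(f(x_i),f(y_i))^q\Big)^{1/q}\le C\sup_{g\in B_{X^\#}}\Big(\sum_{i=1}^n|g(x_i)-g(y_i)|^q\Big)^{1/q}$$ (with maxima over $i$ in place of the $q$-sums when $q=\infty$). The infimum of such $C$ is $\pi_q^L(f)$, and $\Pi_q^L(X,E^* )$ is the set of all Lipschitz $q$-summing maps from $X$ to $E^*$. *)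

theory Defs
  imports "HOL-Analysis.Analysis" "HOL-Library.Function_Algebras"
begin

text \<open>
  The scalar field is a type \<open>'k\<close>, to be instantiated with \<^typ>\<open>real\<close> or \<^typ>\<open>complex\<close>.
  The library has no class of complex normed spaces, so a normed space over \<open>'k\<close> is a type of
  class \<^class>\<open>real_normed_vector\<close> with an explicit scalar multiplication by \<open>'k\<close> that extends
  the real one; over \<^typ>\<open>real\<close> this forces \<open>smul = scaleR\<close>.
\<close>

locale normed_space_over = vector_space smul
  for smul :: "'k::real_normed_field \<Rightarrow> 'e::real_normed_vector \<Rightarrow> 'e" +
  assumes smul_of_real: "smul (of_real r) v = r *\<^sub>R v"
    and norm_smul: "norm (smul c v) = norm c * norm v"

lemma normed_space_over_scaleR: "normed_space_over (scaleR :: real \<Rightarrow> 'e::real_normed_vector \<Rightarrow> 'e)"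
  by unfold_locales (auto simp: algebra_simps)

lemma normed_space_over_complex: "normed_space_over ((*) :: complex \<Rightarrow> complex \<Rightarrow> complex)"
  by unfold_locales (auto simp: algebra_simps norm_mult scaleR_conv_of_real)

text \<open>
  \<open>E\<^sup>*\<close>: the bounded \<open>'k\<close>-linear functionals, as a subset of the bounded real-linear maps, from
  which they inherit the operator norm.
\<close>

definition topological_dual ::
    "('k::real_normed_field \<Rightarrow> 'e::real_normed_vector \<Rightarrow> 'e) \<Rightarrow> ('e \<Rightarrow>\<^sub>L 'k) set" where
  "topological_dual smul = {\<phi>. \<forall>c v. blinfun_apply \<phi> (smul c v) = c * blinfun_apply \<phi> v}"

text \<open>
  A pointed metric space \<open>X\<close> is a type \<open>'a\<close> with a base point \<open>x0\<close>; the target is a subset \<open>Y\<close>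
  of a metric type with base point \<open>y0\<close>.
\<close>

definition Lip0 :: "'a::metric_space \<Rightarrow> 'b::metric_space set \<Rightarrow> 'b \<Rightarrow> ('a \<Rightarrow> 'b) set" where
  "Lip0 x0 Y y0 = {f. f x0 = y0 \<and> range f \<subseteq> Y \<and> (\<exists>C. C-lipschitz_on UNIV f)}"

definition Lip_const :: "('a::metric_space \<Rightarrow> 'b::metric_space) \<Rightarrow> real" where
  "Lip_const f = Inf {C. C-lipschitz_on UNIV f}"

definition lip_dual_ball :: "'a::metric_space \<Rightarrow> ('a \<Rightarrow> 'k::real_normed_field) set" where
  "lip_dual_ball x0 = {g \<in> Lip0 x0 UNIV 0. Lip_const g \<le> 1}"

text \<open>The solution \<open>p'\<close> of \<open>1/p + 1/p' = 1\<close>, with \<open>1/\<infinity> = 0\<close>.\<close>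

definition conjugate_index :: "ennreal \<Rightarrow> ennreal" where
  "conjugate_index p = inverse (1 - inverse p)"

lemma conjugate_index_iff:
  assumes "1 \<le> p"
  shows "inverse p + inverse q = 1 \<longleftrightarrow> q = conjugate_index p"
proof -
  have le: "inverse p \<le> 1"
  proof (cases p)
    case (real r)
    then have "1 \<le> r" using assms by (simp add: ennreal_1[symmetric] del: ennreal_1)
    then show ?thesis
      using real by (simp add: inverse_ennreal ennreal_1[symmetric] field_simps del: ennreal_1)
  qed simp
  then have fin: "inverse p \<noteq> top"
    by (metis ennreal_one_neq_top top_unique)
  have inv_inv: "inverse (inverse a) = a" for a :: ennreal
  proof (cases a)
    case (real r)
    then show ?thesis by (cases "r = 0") (simp_all add: inverse_ennreal)
  qed simp
  have "inverse p + inverse q = 1 \<longleftrightarrow> inverse q = 1 - inverse p"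
    using fin ennreal_ineq_diff_add[OF le] by (metis ennreal_add_diff_cancel_left)
  also have "\<dots> \<longleftrightarrow> q = conjugate_index p"
    unfolding conjugate_index_def by (metis inv_inv)
  finally show ?thesis .
qed

text \<open>The \<open>0\<close> inserted in the maximum only matters for \<open>n = 0\<close>.\<close>

definition lp_norm :: "ennreal \<Rightarrow> nat \<Rightarrow> (nat \<Rightarrow> real) \<Rightarrow> real" where
  "lp_norm p n a =
    (if p = \<infinity> then Max (insert 0 ((\<lambda>i. \<bar>a i\<bar>) ` {..<n}))
     else (\<Sum>i<n. \<bar>a i\<bar> powr enn2real p) powr (1 / enn2real p))"

text \<open>
  The supremum over \<open>B\<^sub>X\<^sub>#\<close>, the unit ball of the \<open>'k\<close>-valued Lipschitz dual; it is a supremum of a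
  nonempty set of reals bounded by the \<open>\<ell>\<^sub>q\<close>-norm of the distances \<open>d(x\<^sub>i, y\<^sub>i)\<close>.
\<close>

definition weak_lp_norm ::
    "'k::real_normed_field itself \<Rightarrow> 'a::metric_space \<Rightarrow> ennreal \<Rightarrow> nat \<Rightarrow>
     (nat \<Rightarrow> 'a) \<Rightarrow> (nat \<Rightarrow> 'a) \<Rightarrow> real" where
  "weak_lp_norm K x0 q n x y =
    (SUP g \<in> (lip_dual_ball x0 :: ('a \<Rightarrow> 'k) set). lp_norm q n (\<lambda>i. norm (g (x i) - g (y i))))"

text \<open>
  Functionals on \<open>Lip\<^sub>0(X, E\<^sup>*)\<close> are extended by \<open>0\<close> outside that set, so that their equality as HOL
  functions is equality on \<open>Lip\<^sub>0(X, E\<^sup>*)\<close>, and pointwise sums and multiples are the right ones.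
\<close>

definition lip_elementary ::
    "('k::real_normed_field \<Rightarrow> 'e::real_normed_vector \<Rightarrow> 'e) \<Rightarrow> 'a::metric_space \<Rightarrow>
     'a \<Rightarrow> 'a \<Rightarrow> 'e \<Rightarrow> (('a \<Rightarrow> 'e \<Rightarrow>\<^sub>L 'k) \<Rightarrow> 'k)" where
  "lip_elementary smul x0 x y e =
    (\<lambda>f. if f \<in> Lip0 x0 (topological_dual smul) 0 then blinfun_apply (f x - f y) e else 0)"

definition lip_tensor_product ::
    "('k::real_normed_field \<Rightarrow> 'e::real_normed_vector \<Rightarrow> 'e) \<Rightarrow> 'a::metric_space \<Rightarrow>
     (('a \<Rightarrow> 'e \<Rightarrow>\<^sub>L 'k) \<Rightarrow> 'k) set" where
  "lip_tensor_product smul x0 =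
    module.span (\<lambda>c u f. c * u f) {lip_elementary smul x0 x y e | x y e. True}"

lemma module_functionals: "module (\<lambda>c u f. c * u f :: 'k::real_normed_field)"
  by unfold_locales (auto simp: algebra_simps fun_eq_iff)

lemma sum_lip_elementary_in_lip_tensor_product:
  fixes smul :: "'k::real_normed_field \<Rightarrow> 'e::real_normed_vector \<Rightarrow> 'e" and x0 :: "'a::metric_space"
  shows "(\<Sum>i<(n::nat). lip_elementary smul x0 (x i) (y i) (e i)) \<in> lip_tensor_product smul x0"
proof -
  interpret module "\<lambda>c (u :: ('a \<Rightarrow> 'e \<Rightarrow>\<^sub>L 'k) \<Rightarrow> 'k) f. c * u f"
    by (rule module_functionals)
  show ?thesis
    unfolding lip_tensor_product_def by (intro span_sum span_base) blast
qed

definition lip_nuclear_norm ::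
    "('k::real_normed_field \<Rightarrow> 'e::real_normed_vector \<Rightarrow> 'e) \<Rightarrow> 'a::metric_space \<Rightarrow> ennreal \<Rightarrow>
     (('a \<Rightarrow> 'e \<Rightarrow>\<^sub>L 'k) \<Rightarrow> 'k) \<Rightarrow> real" where
  "lip_nuclear_norm smul x0 p u =
    Inf {weak_lp_norm TYPE('k) x0 (conjugate_index p) n x y * lp_norm p n (\<lambda>i. norm (e i)) | n x y e.
           u = (\<Sum>i<n. lip_elementary smul x0 (x i) (y i) (e i))}"

definition lip_alpha_bound ::
    "('k::real_normed_field \<Rightarrow> 'e::real_normed_vector \<Rightarrow> 'e) \<Rightarrow> 'a::metric_space \<Rightarrow>
     ((('a \<Rightarrow> 'e \<Rightarrow>\<^sub>L 'k) \<Rightarrow> 'k) \<Rightarrow> real) \<Rightarrow> ('a \<Rightarrow> 'e \<Rightarrow>\<^sub>L 'k) \<Rightarrow> real \<Rightarrow> bool" where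
  "lip_alpha_bound smul x0 \<alpha> f C \<longleftrightarrow>
    (\<forall>u \<in> lip_tensor_product smul x0. \<forall>(n::nat) x y e.
       u = (\<Sum>i<n. lip_elementary smul x0 (x i) (y i) (e i)) \<longrightarrow>
       norm (\<Sum>i<n. blinfun_apply (f (x i) - f (y i)) (e i)) \<le> C * \<alpha> u)"

definition lip_alpha_operators ::
    "('k::real_normed_field \<Rightarrow> 'e::real_normed_vector \<Rightarrow> 'e) \<Rightarrow> 'a::metric_space \<Rightarrow>
     ((('a \<Rightarrow> 'e \<Rightarrow>\<^sub>L 'k) \<Rightarrow> 'k) \<Rightarrow> real) \<Rightarrow> ('a \<Rightarrow> 'e \<Rightarrow>\<^sub>L 'k) set" where
  "lip_alpha_operators smul x0 \<alpha> =
    {f. f x0 = 0 \<and> range f \<subseteq> topological_dual smul \<and> (\<exists>C\<ge>0. lip_alpha_bound smul x0 \<alpha> f C)}"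

definition lip_alpha_norm ::
    "('k::real_normed_field \<Rightarrow> 'e::real_normed_vector \<Rightarrow> 'e) \<Rightarrow> 'a::metric_space \<Rightarrow>
     ((('a \<Rightarrow> 'e \<Rightarrow>\<^sub>L 'k) \<Rightarrow> 'k) \<Rightarrow> real) \<Rightarrow> ('a \<Rightarrow> 'e \<Rightarrow>\<^sub>L 'k) \<Rightarrow> real" where
  "lip_alpha_norm smul x0 \<alpha> f = Inf {C. 0 \<le> C \<and> lip_alpha_bound smul x0 \<alpha> f C}"

definition lip_summing_bound ::
    "'k::real_normed_field itself \<Rightarrow> 'a::metric_space \<Rightarrow> ennreal \<Rightarrow>
     ('a \<Rightarrow> 'b::metric_space) \<Rightarrow> real \<Rightarrow> bool" where
  "lip_summing_bound K x0 q f C \<longleftrightarrow>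
    (\<forall>n x y. lp_norm q n (\<lambda>i. dist (f (x i)) (f (y i))) \<le> C * weak_lp_norm K x0 q n x y)"

definition lip_summing_maps ::
    "'k::real_normed_field itself \<Rightarrow> 'a::metric_space \<Rightarrow> ennreal \<Rightarrow>
     'b::metric_space set \<Rightarrow> 'b \<Rightarrow> ('a \<Rightarrow> 'b) set" where
  "lip_summing_maps K x0 q Y y0 = {f \<in> Lip0 x0 Y y0. \<exists>C\<ge>0. lip_summing_bound K x0 q f C}"

definition lip_summing_norm ::
    "'k::real_normed_field itself \<Rightarrow> 'a::metric_space \<Rightarrow> ennreal \<Rightarrow> ('a \<Rightarrow> 'b::metric_space) \<Rightarrow> real" where
  "lip_summing_norm K x0 q f = Inf {C. 0 \<le> C \<and> lip_summing_bound K x0 q f C}"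

end

theory Submission
  imports Defs
begin

text \<open>
  Both inclusions compare the two defining inequalities with the same constant \<open>C\<close>, so the sets of
  admissible constants coincide and with them the two norms. The argument is the same over every
  real normed field of scalars. Below, \<open>q\<close> is the index conjugate to \<open>p\<close>.

  If \<open>f\<close> is Lipschitz, then evaluation at \<open>f\<close> sends a tensor \<open>u\<close> to a scalar that can be computed from
  any representation of \<open>u\<close>. For each of them, Hoelder's inequality bounds this scalar by the
  \<open>\<ell>\<^sub>q\<close>-norm of the distances \<open>\<parallel>f x\<^sub>i - f y\<^sub>i\<parallel>\<close> times the \<open>\<ell>\<^sub>p\<close>-norm of the \<open>\<parallel>e\<^sub>i\<parallel>\<close>. A summing bound for
  \<open>f\<close> controls the first factor, and the infimum over all representations gives the bound by the
  nuclear norm (\<open>alpha_bound_if_summing_bound\<close>).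

  Conversely, every family of vectors \<open>e\<^sub>i\<close> turns points \<open>x\<^sub>i, y\<^sub>i\<close> into a tensor whose nuclear norm
  is at most the cost of this one representation. Choose \<open>e\<^sub>i\<close> of length at most \<open>\<lambda>\<^sub>i\<close> in a direction in which
  \<open>f x\<^sub>i - f y\<^sub>i\<close> almost attains its norm with a nonnegative real value
  (\<open>dual_norm_almost_attained\<close>). This bounds \<open>\<Sum>\<lambda>\<^sub>i \<parallel>f x\<^sub>i - f y\<^sub>i\<parallel>\<close> for all weights \<open>\<lambda>\<close>, and
  the converse of Hoelder's inequality (\<open>lp_norm_le_by_duality\<close>) turns this into a bound on an
  \<open>\<ell>\<^sub>q\<close>-norm (\<open>summing_bound_if_alpha_bound\<close>). The summing
  inequality for a single pair of points says that such an operator is Lipschitz.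
\<close>

section \<open>Conjugate exponents and duality of finite sequence norms\<close>

lemma conjugate_index_cases:
  assumes "1 \<le> p"
  obtains "p = 1" "conjugate_index p = \<infinity>"
  | "p = \<infinity>" "conjugate_index p = 1"
  | r s where "p = ennreal r" "conjugate_index p = ennreal s" "r > 1" "s > 1" "1 / r + 1 / s = 1"
proof (cases p)
  case (real r)
  have "ennreal 1 \<le> ennreal r" using assms real by simp
  then have r: "1 \<le> r" using real by (simp del: ennreal_1)
  show ?thesis
  proof (cases "r = 1")
    case True
    then show ?thesis using that(1) real by (simp add: conjugate_index_def)
  next
    case False
    with r have "r > 1" by simp
    define s where "s = inverse (1 - inverse r)"
    have pos: "0 < 1 - inverse r" "1 - inverse r < 1" using \<open>r > 1\<close> by (auto simp: field_simps)
    have "1 - inverse (ennreal r) = ennreal 1 - ennreal (inverse r)"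
      using \<open>r > 1\<close> by (simp add: inverse_ennreal)
    also have "\<dots> = ennreal (1 - inverse r)" using \<open>r > 1\<close> by (intro ennreal_minus) simp
    finally have "conjugate_index p = ennreal s"
      unfolding conjugate_index_def s_def using pos real by (simp add: inverse_ennreal)
    moreover have "s > 1" unfolding s_def using pos by (simp add: one_less_inverse)
    moreover have "1 / r + 1 / s = 1" unfolding s_def using \<open>r > 1\<close> by (simp add: field_simps)
    ultimately show ?thesis using that(3) real \<open>r > 1\<close> by blast
  qed
next
  case top
  then show ?thesis using that(2) by (simp add: conjugate_index_def)
qed

lemma one_le_conjugate_index:
  assumes "1 \<le> p"
  shows "1 \<le> conjugate_index p"
  using assms
proof (cases p rule: conjugate_index_cases)
  case (3 r s)
  then have "ennreal 1 \<le> ennreal s" by (intro ennreal_leI) simp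
  then show ?thesis using 3 by simp
qed auto

lemma lp_norm_infinity: "lp_norm \<infinity> n a = Max (insert 0 ((\<lambda>i. \<bar>a i\<bar>) ` {..<n}))"
  by (simp add: lp_norm_def)

lemma lp_norm_one: "lp_norm 1 n a = (\<Sum>i<n. \<bar>a i\<bar>)"
  by (simp add: lp_norm_def sum_nonneg)

lemma lp_norm_ennreal:
  assumes "0 \<le> r"
  shows "lp_norm (ennreal r) n a = (\<Sum>i<n. \<bar>a i\<bar> powr r) powr (1 / r)"
  using assms by (simp add: lp_norm_def)

lemma lp_norm_nonneg: "0 \<le> lp_norm p n a"
  by (simp add: lp_norm_def)

lemma abs_le_lp_norm_infinity: "i < n \<Longrightarrow> \<bar>a i\<bar> \<le> lp_norm \<infinity> n a"
  unfolding lp_norm_infinity by simp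

lemma lp_norm_infinity_le:
  assumes "0 \<le> M" and "\<And>i. i < n \<Longrightarrow> \<bar>a i\<bar> \<le> M"
  shows "lp_norm \<infinity> n a \<le> M"
  unfolding lp_norm_infinity using assms by auto

lemma lp_norm_mono:
  assumes "\<And>i. i < n \<Longrightarrow> \<bar>a i\<bar> \<le> \<bar>b i\<bar>"
  shows "lp_norm p n a \<le> lp_norm p n b"
proof (cases "p = \<infinity>")
  case True
  show ?thesis unfolding True
    by (intro lp_norm_infinity_le lp_norm_nonneg)
      (use assms abs_le_lp_norm_infinity order_trans in blast)
next
  case False
  have "(\<Sum>i<n. \<bar>a i\<bar> powr enn2real p) \<le> (\<Sum>i<n. \<bar>b i\<bar> powr enn2real p)"
    using assms by (intro sum_mono powr_mono2) auto
  then show ?thesis using False by (simp add: lp_norm_def powr_mono2 sum_nonneg)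
qed

lemma lp_norm_singleton:
  assumes "1 \<le> p"
  shows "lp_norm p 1 a = \<bar>a 0\<bar>"
proof -
  have "enn2real p \<noteq> 0" if "p \<noteq> \<infinity>"
    using assms that by (auto simp: enn2real_eq_0_iff)
  moreover have "{..<1::nat} = {0}" by auto
  ultimately show ?thesis by (simp add: lp_norm_def powr_powr)
qed

text \<open>
  Hoelder's inequality for exponents strictly between \<open>1\<close> and \<open>\<infinity>\<close>: after scaling both families to
  norm \<open>1\<close>, sum Young's inequality over the entries.
\<close>

lemma Holder_sum_powr:
  fixes a b :: "'i \<Rightarrow> real"
  assumes rs: "r > 1" "s > 1" "1 / r + 1 / s = 1"
    and nonneg: "\<And>i. i \<in> I \<Longrightarrow> 0 \<le> a i" "\<And>i. i \<in> I \<Longrightarrow> 0 \<le> b i" and "finite I"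
  shows "(\<Sum>i\<in>I. a i * b i) \<le> (\<Sum>i\<in>I. a i powr r) powr (1 / r) * (\<Sum>i\<in>I. b i powr s) powr (1 / s)"
proof -
  define A where "A = (\<Sum>i\<in>I. a i powr r) powr (1 / r)"
  define B where "B = (\<Sum>i\<in>I. b i powr s) powr (1 / s)"
  have A: "A powr r = (\<Sum>i\<in>I. a i powr r)" and B: "B powr s = (\<Sum>i\<in>I. b i powr s)"
    unfolding A_def B_def using rs by (simp_all add: powr_powr sum_nonneg)
  show ?thesis
  proof (cases "A = 0 \<or> B = 0")
    case True
    then have "(\<Sum>i\<in>I. a i powr r) = 0 \<or> (\<Sum>i\<in>I. b i powr s) = 0"
      using A B by auto
    then have "\<forall>i\<in>I. a i * b i = 0"
      using \<open>finite I\<close> by (auto simp: sum_nonneg_eq_0_iff)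
    then have "(\<Sum>i\<in>I. a i * b i) = 0" by (intro sum.neutral)
    then show ?thesis by simp
  next
    case False
    then have pos: "0 < A" "0 < B" by (auto simp: A_def B_def)
    have "(\<Sum>i\<in>I. a i / A * (b i / B)) \<le> (\<Sum>i\<in>I. (a i / A) powr r / r + (b i / B) powr s / s)"
      using nonneg pos rs by (intro sum_mono Youngs_inequality) auto
    also have "\<dots> = (\<Sum>i\<in>I. a i powr r / A powr r / r + b i powr s / B powr s / s)"
      using nonneg pos by (intro sum.cong refl) (simp add: powr_divide)
    also have "\<dots> = (\<Sum>i\<in>I. a i powr r) / A powr r / r + (\<Sum>i\<in>I. b i powr s) / B powr s / s"
      by (simp add: sum.distrib sum_divide_distrib)
    also have "\<dots> = 1"
      using pos rs by (simp flip: A B)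
    finally have "(\<Sum>i\<in>I. a i * b i) / (A * B) \<le> 1"
      by (simp add: sum_divide_distrib)
    then show ?thesis using pos unfolding A_def[symmetric] B_def[symmetric]
      by (simp add: divide_le_eq)
  qed
qed

lemma lp_norm_Holder:
  assumes "1 \<le> p"
  shows "(\<Sum>i<n. \<bar>a i\<bar> * \<bar>b i\<bar>) \<le> lp_norm (conjugate_index p) n a * lp_norm p n b"
  using assms
proof (cases p rule: conjugate_index_cases)
  case 1
  have "(\<Sum>i<n. \<bar>a i\<bar> * \<bar>b i\<bar>) \<le> (\<Sum>i<n. lp_norm \<infinity> n a * \<bar>b i\<bar>)"
    by (intro sum_mono mult_right_mono abs_le_lp_norm_infinity) auto
  then show ?thesis unfolding 1(2) unfolding 1(1) by (simp add: lp_norm_one sum_distrib_left)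
next
  case 2
  have "(\<Sum>i<n. \<bar>a i\<bar> * \<bar>b i\<bar>) \<le> (\<Sum>i<n. \<bar>a i\<bar> * lp_norm \<infinity> n b)"
    by (intro sum_mono mult_left_mono abs_le_lp_norm_infinity) auto
  then show ?thesis unfolding 2(2) unfolding 2(1) by (simp add: lp_norm_one sum_distrib_right)
next
  case (3 r s)
  then show ?thesis
    unfolding 3(2) unfolding 3(1)
    using Holder_sum_powr[of s r "{..<n}" "\<lambda>i. \<bar>a i\<bar>" "\<lambda>i. \<bar>b i\<bar>"]
    by (simp add: lp_norm_ennreal add.commute)
qed

text \<open>
  The converse of Hoelder's inequality. The extremal weights are the unit vectors for \<open>p = 1\<close>, the
  constant \<open>1\<close> for \<open>p = \<infinity>\<close>, and \<open>a\<^sub>i\<close> to the power \<open>s - 1\<close> in between, where \<open>s\<close> is conjugate to \<open>p\<close>.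
\<close>

lemma lp_norm_le_by_duality:
  assumes "1 \<le> p" and "0 \<le> M" and a: "\<And>i. 0 \<le> a i"
    and weights: "\<And>w. (\<And>i. 0 \<le> w i) \<Longrightarrow> (\<Sum>i<n. w i * a i) \<le> M * lp_norm p n w"
  shows "lp_norm (conjugate_index p) n a \<le> M"
  using \<open>1 \<le> p\<close>
proof (cases p rule: conjugate_index_cases)
  case 1
  have "a j \<le> M" if "j < n" for j
    using weights[of "\<lambda>i. if i = j then 1 else 0"] that
    unfolding 1(1) by (simp add: lp_norm_one if_distrib[of abs] if_distrib[of "\<lambda>x. x * _"] cong: if_cong)
  then show ?thesis unfolding 1(2) using a \<open>0 \<le> M\<close> by (intro lp_norm_infinity_le) auto
next
  case 2
  have "(\<Sum>i<n. a i) \<le> M * lp_norm \<infinity> n (\<lambda>i. 1)"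
    using weights[of "\<lambda>i. 1"] unfolding 2(1) by simp
  also have "\<dots> \<le> M * 1"
    using \<open>0 \<le> M\<close> by (intro mult_left_mono lp_norm_infinity_le) auto
  finally show ?thesis unfolding 2(2) using a by (simp add: lp_norm_one)
next
  case (3 r s)
  define S where "S = (\<Sum>i<n. a i powr s)"
  have "0 \<le> S" by (simp add: S_def sum_nonneg)
  have exponents: "(s - 1) * r = s" "1 - 1 / r = 1 / s"
    using 3 by (simp_all add: field_simps)
  have "a i powr (s - 1) * a i = a i powr s" for i
    using a[of i] 3 powr_add[of "a i" "s - 1" 1] by (cases "a i = 0") auto
  then have "S \<le> M * S powr (1 / r)"
    using weights[of "\<lambda>i. a i powr (s - 1)"] 3 exponents
    by (simp add: S_def lp_norm_ennreal powr_powr)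
  then have "S powr (1 / s) \<le> M"
  proof (cases "S = 0")
    case False
    with \<open>0 \<le> S\<close> have "0 < S" by simp
    have "S powr (1 / s) = S / S powr (1 / r)"
      using \<open>0 < S\<close> powr_diff[of S 1 "1 / r"] exponents by simp
    also have "\<dots> \<le> M" using \<open>S \<le> M * S powr (1 / r)\<close> \<open>0 < S\<close> by (simp add: divide_le_eq)
    finally show ?thesis .
  qed (use \<open>0 \<le> M\<close> in simp)
  then show ?thesis unfolding 3(2) using a 3 by (simp add: lp_norm_ennreal S_def)
qed

section \<open>The weak norm of a family of pairs of points\<close>

text \<open>
  A Lipschitz constant is an infimum, so the inequality with constant \<open>1\<close> is reached as a limit.
\<close>

lemma lip_dual_ball_nonexpansive:
  assumes "g \<in> lip_dual_ball x0"
  shows "norm (g x - g y) \<le> dist x y"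
proof -
  have L: "{C. C-lipschitz_on UNIV g} \<noteq> {}" "Inf {C. C-lipschitz_on UNIV g} \<le> 1"
    using assms by (auto simp: lip_dual_ball_def Lip0_def Lip_const_def)
  show ?thesis
  proof (rule field_le_epsilon)
    fix e :: real assume "0 < e"
    define d where "d = e / (dist x y + 1)"
    have "0 < dist x y + 1" by (simp add: add_nonneg_pos)
    then have "0 < d" using \<open>0 < e\<close> by (simp add: d_def)
    then have "Inf {C. C-lipschitz_on UNIV g} < 1 + d" using L by simp
    then obtain C where C: "C-lipschitz_on UNIV g" "C < 1 + d"
      using cInf_lessD[OF L(1)] by blast
    have "norm (g x - g y) \<le> C * dist x y"
      using lipschitz_onD[OF C(1)] by (simp add: dist_norm)
    also have "\<dots> \<le> (1 + d) * dist x y" using C by (intro mult_right_mono) auto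
    also have "\<dots> = dist x y + d * dist x y" by (simp add: algebra_simps)
    also have "d * dist x y \<le> d * (dist x y + 1)" using \<open>0 < d\<close> by simp
    also have "\<dots> = e" unfolding d_def using \<open>0 < dist x y + 1\<close> by simp
    finally show "norm (g x - g y) \<le> dist x y + e" by simp
  qed
qed

lemma zero_in_lip_dual_ball:
  fixes x0 :: "'a::metric_space"
  shows "(\<lambda>x. 0 :: 'k::real_normed_field) \<in> lip_dual_ball x0"
proof -
  have lip: "0-lipschitz_on UNIV (\<lambda>x::'a. 0::'k)"
    by (simp add: lipschitz_on_def)
  have "Inf {C. C-lipschitz_on UNIV (\<lambda>x::'a. 0::'k)} \<le> 0"
    using lip by (intro cInf_lower) (auto simp: bdd_below_def lipschitz_on_def)
  then show ?thesis using lip by (auto simp: lip_dual_ball_def Lip0_def Lip_const_def)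
qed

text \<open>
  The supremum dominates the value at \<open>g = 0\<close>; this relies on the supremum being bounded, here by
  the \<open>\<ell>\<^sub>q\<close>-norm of the distances.
\<close>

lemma weak_lp_norm_nonneg:
  fixes x0 :: "'a::metric_space"
  shows "0 \<le> weak_lp_norm TYPE('k::real_normed_field) x0 q n x y"
proof -
  have "bdd_above ((\<lambda>g. lp_norm q n (\<lambda>i. norm (g (x i) - g (y i)))) ` (lip_dual_ball x0 :: ('a \<Rightarrow> 'k) set))"
    by (rule bdd_aboveI2[of _ _ "lp_norm q n (\<lambda>i. dist (x i) (y i))"])
      (simp add: lip_dual_ball_nonexpansive lp_norm_mono)
  then show ?thesis unfolding weak_lp_norm_def
    by (rule order_trans[OF lp_norm_nonneg cSUP_upper[OF zero_in_lip_dual_ball]])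
qed

lemma weak_lp_norm_singleton_le:
  fixes x0 :: "'a::metric_space"
  assumes "1 \<le> q"
  shows "weak_lp_norm TYPE('k::real_normed_field) x0 q 1 x y \<le> dist (x 0) (y 0)"
  unfolding weak_lp_norm_def
proof (rule cSUP_least)
  show "(lip_dual_ball x0 :: ('a \<Rightarrow> 'k) set) \<noteq> {}"
    using zero_in_lip_dual_ball by blast
  show "lp_norm q 1 (\<lambda>i. norm (g (x i) - g (y i))) \<le> dist (x 0) (y 0)"
    if "g \<in> lip_dual_ball x0" for g :: "'a \<Rightarrow> 'k"
    unfolding lp_norm_singleton[OF assms] using lip_dual_ball_nonexpansive[OF that] by simp
qed

section \<open>Tensors and dual functionals\<close>

lemma lip_nuclear_norm_le:
  fixes smul :: "'k::real_normed_field \<Rightarrow> 'e::real_normed_vector \<Rightarrow> 'e"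
  shows "lip_nuclear_norm smul x0 p (\<Sum>i<n. lip_elementary smul x0 (x i) (y i) (e i))
    \<le> weak_lp_norm TYPE('k) x0 (conjugate_index p) n x y * lp_norm p n (\<lambda>i. norm (e i))"
  unfolding lip_nuclear_norm_def
proof (rule cInf_lower)
  show "bdd_below {weak_lp_norm TYPE('k) x0 (conjugate_index p) m x' y' * lp_norm p m (\<lambda>i. norm (e' i)) | m x' y' e'.
      (\<Sum>i<n. lip_elementary smul x0 (x i) (y i) (e i))
        = (\<Sum>i<m. lip_elementary smul x0 (x' i) (y' i) (e' i))}"
    by (rule bdd_belowI[of _ 0]) (auto intro!: mult_nonneg_nonneg weak_lp_norm_nonneg lp_norm_nonneg)
qed blast

lemma sum_lip_elementary_apply:
  assumes "f \<in> Lip0 x0 (topological_dual smul) 0"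
  shows "(\<Sum>i<(n::nat). lip_elementary smul x0 (x i) (y i) (e i)) f = (\<Sum>i<n. blinfun_apply (f (x i) - f (y i)) (e i))"
  using assms by (induction n) (auto simp: lip_elementary_def)

text \<open>
  Multiplying by a scalar normalizes a vector and makes the value at an almost extremal
  direction real and nonnegative, so that several such values add up without cancellation.
\<close>

lemma dual_norm_almost_attained:
  fixes smul :: "'k::real_normed_field \<Rightarrow> 'e::real_normed_vector \<Rightarrow> 'e"
  assumes "normed_space_over smul" and \<phi>: "\<phi> \<in> topological_dual smul" and t: "0 \<le> t" "t < 1"
  shows "\<exists>v r. norm v \<le> 1 \<and> blinfun_apply \<phi> v = of_real r \<and> t * norm \<phi> \<le> r"
proof (cases "norm \<phi> = 0")
  case True
  then show ?thesis by (intro exI[of _ 0]) auto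
next
  case False
  then have "t * norm \<phi> < norm \<phi>" using t by simp
  then obtain x where x: "t * norm \<phi> * norm x < norm (blinfun_apply \<phi> x)"
    using norm_blinfun_bound[of "t * norm \<phi>" \<phi>] t by (meson mult_nonneg_nonneg norm_ge_zero not_le)
  have "0 \<le> t * norm \<phi> * norm x" using t by simp
  then have "0 < norm (blinfun_apply \<phi> x)" using x by linarith
  then have nz: "x \<noteq> 0" "blinfun_apply \<phi> x \<noteq> 0" by (auto simp: blinfun.zero_right)
  define r where "r = norm (blinfun_apply \<phi> x) / norm x"
  define v where "v = smul (of_real r / blinfun_apply \<phi> x) x"
  have "norm v = 1" unfolding v_def r_def
    using nz by (simp add: normed_space_over.norm_smul[OF assms(1)] norm_divide norm_mult)
  moreover have "blinfun_apply \<phi> v = of_real r"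
    using nz \<phi> by (simp add: v_def topological_dual_def)
  moreover have "t * norm \<phi> \<le> r" using x nz by (simp add: r_def field_simps)
  ultimately show ?thesis by (intro exI[of _ v] exI[of _ r]) simp
qed

lemma topological_dual_diff:
  assumes "\<phi> \<in> topological_dual smul" "\<psi> \<in> topological_dual smul"
  shows "\<phi> - \<psi> \<in> topological_dual smul"
  using assms by (simp add: topological_dual_def blinfun.diff_left algebra_simps)

section \<open>Comparing the two bounds\<close>

text \<open>
  The Lipschitz hypothesis on \<open>f\<close> makes evaluation at \<open>f\<close> meaningful on tensors: two
  representations are equal exactly when they agree on all Lipschitz maps that respect the base
  points.
\<close>

lemma alpha_bound_if_summing_bound:
  fixes smul :: "'k::real_normed_field \<Rightarrow> 'e::real_normed_vector \<Rightarrow> 'e"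
  assumes "1 \<le> p" and "0 \<le> C" and f: "f \<in> Lip0 x0 (topological_dual smul) 0"
    and summing: "lip_summing_bound TYPE('k) x0 (conjugate_index p) f C"
  shows "lip_alpha_bound smul x0 (lip_nuclear_norm smul x0 p) f C"
  unfolding lip_alpha_bound_def
proof (intro ballI allI impI)
  fix u x y e and n :: nat
  assume u: "u = (\<Sum>i<n. lip_elementary smul x0 (x i) (y i) (e i))"
  \<comment> \<open>The scalar \<open>u f\<close> is the same for all representations, so each of them may be used to bound it.\<close>
  have representation: "norm (u f) \<le> C * (weak_lp_norm TYPE('k) x0 (conjugate_index p) m x' y' * lp_norm p m (\<lambda>i. norm (e' i)))"
    if "u = (\<Sum>i<m. lip_elementary smul x0 (x' i) (y' i) (e' i))" for m x' y' e'
  proof -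
    have "norm (u f) = norm (\<Sum>i<m. blinfun_apply (f (x' i) - f (y' i)) (e' i))"
      by (simp only: that sum_lip_elementary_apply[OF f])
    also have "\<dots> \<le> (\<Sum>i<m. \<bar>dist (f (x' i)) (f (y' i))\<bar> * \<bar>norm (e' i)\<bar>)"
      by (rule sum_norm_le) (simp add: dist_norm norm_blinfun)
    also have "\<dots> \<le> lp_norm (conjugate_index p) m (\<lambda>i. dist (f (x' i)) (f (y' i))) * lp_norm p m (\<lambda>i. norm (e' i))"
      by (rule lp_norm_Holder[OF \<open>1 \<le> p\<close>])
    also have "\<dots> \<le> C * weak_lp_norm TYPE('k) x0 (conjugate_index p) m x' y' * lp_norm p m (\<lambda>i. norm (e' i))"
      using summing by (intro mult_right_mono lp_norm_nonneg) (simp add: lip_summing_bound_def)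
    finally show ?thesis by (simp add: mult.assoc)
  qed
  have "norm (u f) \<le> C * lip_nuclear_norm smul x0 p u"
  proof (cases "C = 0")
    case True
    then show ?thesis using representation[OF u] by simp
  next
    case False
    with \<open>0 \<le> C\<close> have "0 < C" by simp
    have "norm (u f) / C \<le> lip_nuclear_norm smul x0 p u"
      unfolding lip_nuclear_norm_def
      by (rule cInf_greatest)
        (use u representation \<open>0 < C\<close> in \<open>auto simp: pos_divide_le_eq mult.commute[of _ C]\<close>)
    then show ?thesis using \<open>0 < C\<close> by (simp add: pos_divide_le_eq mult.commute)
  qed
  then show "norm (\<Sum>i<n. blinfun_apply (f (x i) - f (y i)) (e i)) \<le> C * lip_nuclear_norm smul x0 p u"
    using u by (simp only: sum_lip_elementary_apply[OF f])
qed

text \<open>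
  The nuclear norm of a tensor is at most the cost of any one of its representations. The vectors
  in the representation are free, and testing with all of them recovers the norms of the functionals
  \<open>f x\<^sub>i - f y\<^sub>i\<close>.
\<close>

lemma summing_bound_if_alpha_bound:
  fixes smul :: "'k::real_normed_field \<Rightarrow> 'e::real_normed_vector \<Rightarrow> 'e"
  assumes "normed_space_over smul" and "1 \<le> p" and "0 \<le> C"
    and f: "range f \<subseteq> topological_dual smul"
    and alpha: "lip_alpha_bound smul x0 (lip_nuclear_norm smul x0 p) f C"
  shows "lip_summing_bound TYPE('k) x0 (conjugate_index p) f C"
  unfolding lip_summing_bound_def
proof (intro allI)
  fix n x y
  let ?W = "weak_lp_norm TYPE('k) x0 (conjugate_index p) n x y"
  let ?a = "\<lambda>i. norm (f (x i) - f (y i))"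
  have "(\<Sum>i<n. w i * ?a i) \<le> C * ?W * lp_norm p n w" if w: "\<And>i. 0 \<le> w i" for w
    \<comment> \<open>Functionals need not attain their norm on the unit ball, hence the factor \<open>t < 1\<close>.\<close>
  proof (rule field_le_mult_one_interval)
    fix t :: real assume t: "0 < t" "t < 1"
    have "\<forall>i. \<exists>v r. norm v \<le> 1 \<and> blinfun_apply (f (x i) - f (y i)) v = of_real r \<and> t * ?a i \<le> r"
      using f t by (intro allI dual_norm_almost_attained[OF assms(1)] topological_dual_diff) auto
    then obtain v r where v: "\<And>i. norm (v i) \<le> 1"
      and r: "\<And>i. blinfun_apply (f (x i) - f (y i)) (v i) = of_real (r i)" "\<And>i. t * ?a i \<le> r i"
      by metis
    define e where "e i = w i *\<^sub>R v i" for i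
    have "t * (\<Sum>i<n. w i * ?a i) = (\<Sum>i<n. w i * (t * ?a i))"
      by (simp add: sum_distrib_left algebra_simps)
    also have "\<dots> \<le> (\<Sum>i<n. w i * r i)"
      using w r by (intro sum_mono mult_left_mono)
    also have "\<dots> \<le> norm (of_real (\<Sum>i<n. w i * r i) :: 'k)"
      unfolding norm_of_real by (rule abs_ge_self)
    also have "(of_real (\<Sum>i<n. w i * r i) :: 'k) = (\<Sum>i<n. blinfun_apply (f (x i) - f (y i)) (e i))"
      by (simp add: e_def blinfun.scaleR_right r scaleR_conv_of_real)
    also have "norm \<dots> \<le> C * lip_nuclear_norm smul x0 p (\<Sum>i<n. lip_elementary smul x0 (x i) (y i) (e i))"
      using alpha sum_lip_elementary_in_lip_tensor_product unfolding lip_alpha_bound_def by blast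
    also have "\<dots> \<le> C * (?W * lp_norm p n (\<lambda>i. norm (e i)))"
      by (intro mult_left_mono lip_nuclear_norm_le \<open>0 \<le> C\<close>)
    also have "\<dots> \<le> C * (?W * lp_norm p n w)"
      using w v by (intro mult_left_mono lp_norm_mono weak_lp_norm_nonneg \<open>0 \<le> C\<close>)
        (simp add: e_def mult_left_le)
    finally show "t * (\<Sum>i<n. w i * ?a i) \<le> C * ?W * lp_norm p n w" by (simp add: mult.assoc)
  qed
  then show "lp_norm (conjugate_index p) n (\<lambda>i. dist (f (x i)) (f (y i))) \<le> C * ?W"
    unfolding dist_norm
    by (intro lp_norm_le_by_duality[OF \<open>1 \<le> p\<close>] mult_nonneg_nonneg weak_lp_norm_nonneg \<open>0 \<le> C\<close>) auto
qed

lemma lipschitz_on_if_summing_bound: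
  assumes "1 \<le> q" and "0 \<le> C" and summing: "lip_summing_bound TYPE('k::real_normed_field) x0 q f C"
  shows "C-lipschitz_on UNIV f"
proof (rule lipschitz_onI)
  fix x y
  have "lp_norm q 1 (\<lambda>i. dist (f x) (f y)) \<le> C * weak_lp_norm TYPE('k) x0 q 1 (\<lambda>i. x) (\<lambda>i. y)"
    using summing[unfolded lip_summing_bound_def, rule_format, of 1 "\<lambda>i. x" "\<lambda>i. y"] .
  also have "\<dots> \<le> C * dist x y"
    by (intro mult_left_mono weak_lp_norm_singleton_le \<open>1 \<le> q\<close> \<open>0 \<le> C\<close>)
  finally show "dist (f x) (f y) \<le> C * dist x y"
    by (simp only: lp_norm_singleton[OF \<open>1 \<le> q\<close>] abs_of_nonneg zero_le_dist)
qed (fact \<open>0 \<le> C\<close>)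

theorem lip_nuclear_operators_eq_summing_maps:
  fixes smul :: "'k::real_normed_field \<Rightarrow> 'e::real_normed_vector \<Rightarrow> 'e"
  assumes "normed_space_over smul" and "1 \<le> p"
  shows "lip_alpha_operators smul x0 (lip_nuclear_norm smul x0 p)
      = lip_summing_maps TYPE('k) x0 (conjugate_index p) (topological_dual smul) 0"
    and "f \<in> lip_alpha_operators smul x0 (lip_nuclear_norm smul x0 p) \<Longrightarrow>
      lip_alpha_norm smul x0 (lip_nuclear_norm smul x0 p) f
      = lip_summing_norm TYPE('k) x0 (conjugate_index p) f"
proof -
  let ?\<alpha> = "lip_nuclear_norm smul x0 p"
  let ?Lip = "Lip0 x0 (topological_dual smul) 0"
  have lip: "f \<in> ?Lip" if f: "f \<in> lip_alpha_operators smul x0 ?\<alpha>" for f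
  proof -
    obtain C where "f x0 = 0" "range f \<subseteq> topological_dual smul" "0 \<le> C" "lip_alpha_bound smul x0 ?\<alpha> f C"
      using f unfolding lip_alpha_operators_def by blast
    then show ?thesis
      using summing_bound_if_alpha_bound[OF assms] one_le_conjugate_index[OF \<open>1 \<le> p\<close>]
        lipschitz_on_if_summing_bound unfolding Lip0_def by blast
  qed
  have bounds: "lip_alpha_bound smul x0 ?\<alpha> f C \<longleftrightarrow> lip_summing_bound TYPE('k) x0 (conjugate_index p) f C"
    if "f \<in> ?Lip" "0 \<le> C" for f C
    using that summing_bound_if_alpha_bound[OF assms \<open>0 \<le> C\<close>]
      alpha_bound_if_summing_bound[OF \<open>1 \<le> p\<close> \<open>0 \<le> C\<close> \<open>f \<in> ?Lip\<close>] by (auto simp: Lip0_def)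
  have "f \<in> lip_alpha_operators smul x0 ?\<alpha> \<longleftrightarrow> f \<in> ?Lip \<and> (\<exists>C\<ge>0. lip_alpha_bound smul x0 ?\<alpha> f C)" for f
    using lip by (auto simp: lip_alpha_operators_def Lip0_def)
  then show "lip_alpha_operators smul x0 ?\<alpha>
      = lip_summing_maps TYPE('k) x0 (conjugate_index p) (topological_dual smul) 0"
    unfolding lip_summing_maps_def using bounds by blast
  show "lip_alpha_norm smul x0 ?\<alpha> f = lip_summing_norm TYPE('k) x0 (conjugate_index p) f"
    if "f \<in> lip_alpha_operators smul x0 ?\<alpha>"
    unfolding lip_alpha_norm_def lip_summing_norm_def
    using bounds[OF lip[OF that]] by (metis (no_types, lifting))
qed

theorem theorem2p6:
  fixes x0 :: "'a::metric_space"
    and p p' :: ennreal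
    and smul :: "complex \<Rightarrow> 'f::banach \<Rightarrow> 'f"
  assumes "1 \<le> p" and "p' = conjugate_index p"
    and "normed_space_over smul"
  shows
    "(lip_alpha_operators (scaleR :: real \<Rightarrow> 'e::banach \<Rightarrow> 'e) x0 (lip_nuclear_norm scaleR x0 p)
        = lip_summing_maps TYPE(real) x0 p' (topological_dual scaleR) 0
      \<and> (\<forall>f \<in> lip_alpha_operators (scaleR :: real \<Rightarrow> 'e \<Rightarrow> 'e) x0 (lip_nuclear_norm scaleR x0 p).
           lip_alpha_norm scaleR x0 (lip_nuclear_norm scaleR x0 p) f
           = lip_summing_norm TYPE(real) x0 p' f))
     \<and>
     (lip_alpha_operators smul x0 (lip_nuclear_norm smul x0 p)
        = lip_summing_maps TYPE(complex) x0 p' (topological_dual smul) 0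
      \<and> (\<forall>f \<in> lip_alpha_operators smul x0 (lip_nuclear_norm smul x0 p).
           lip_alpha_norm smul x0 (lip_nuclear_norm smul x0 p) f
           = lip_summing_norm TYPE(complex) x0 p' f))"
  unfolding assms(2)
  using lip_nuclear_operators_eq_summing_maps[OF normed_space_over_scaleR assms(1), where ?x0.0 = x0]
    lip_nuclear_operators_eq_summing_maps[OF assms(3,1), where ?x0.0 = x0]
  by blast

end
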